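(* Let $Q\subset\mathbb{C}^n$ be a complete circular domain centered at $0\in Q$, and let $p>0$. Let $f$ be holomorphic in $Q$ with homogeneous expansion $f(z)=\sum_{k=0}^\infty P_k(z)$ converging in $Q$ and $|f(z)|<1$ for all $z\in Q$, and put $a=|f(0)|<1$. Let $r_{a,p}$ be the minimum positive root in $(0,1)$ of the equation $A_{a,p}(r)=0$, where $$A_{a,p}(r)=[1-(2-a^2)r](1+ar)^p-(1-r)(r+a)^p.$$ Then $$|f(z)|^p+\sum_{k=1}^{\infty}|P_k(z)|+\left(\frac1{1+a}+\frac r{1-r}\right)\sum_{k=1}^{\infty}|P_k(z)|^2\le 1\qquad( * )$$ for all $z\in r_{a,p}\,Q$ and all $0\le r\le r_{a,p}$. Moreover, if $Q$ is convex, then the number $r_{a,p}$ cannot be improved: for every $a\in[0,1)$ and every $\rho\in(r_{a,p},1]$ there exist a holomorphic $f$ on $Q$ with $|f|<1$ on $Q$ and $|f(0)|=a$, a point $z\in\rho Q$, and $0\le r\le\rho$ with $r<1$, for which $( * )$ fails.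
   Context: A domain $Q\subset\mathbb{C}^n$ is a complete circular domain centered at $0\in Q$ if $\xi z=(\xi z_1,\ldots,\xi z_n)\in Q$ for every $z\in Q$ and every $\xi\in\mathbb{C}$ with $|\xi|\le 1$. Every holomorphic function $f$ on such a $Q$ has an expansion $f(z)=\sum_{k=0}^\infty P_k(z)$, $z\in Q$, where $P_k$ is a homogeneous polynomial of degree $k$ and $P_0=f(0)$. For $\rho>0$, the homothetic domain is $\rho Q=\{\rho z: z\in Q\}$.
   Formalization: In the sharpness part Q is additionally assumed to be different from the whole space C^n; for Q = C^n every bounded holomorphic f is constant by Liouville, so ( * ) always holds and the sharpness claim is false. *)

theory Defs
  imports "HOL-Analysis.Analysis"
begin

definition complete_circular_domain :: "(complex ^ 'n) set \<Rightarrow> bool" where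
  "complete_circular_domain Q \<longleftrightarrow>
     open Q \<and> connected Q \<and> 0 \<in> Q \<and>
     (\<forall>z\<in>Q. \<forall>\<xi>::complex. norm \<xi> \<le> 1 \<longrightarrow> \<xi> *s z \<in> Q)"

definition homothetic :: "real \<Rightarrow> (complex ^ 'n) set \<Rightarrow> (complex ^ 'n) set" where
  "homothetic \<rho> Q = (\<lambda>z. \<rho> *\<^sub>R z) ` Q"

text \<open>
  Holomorphy in several variables (on an open set) is Frechet differentiability at every
  point with a complex-linear derivative; \<open>has_derivative\<close> by itself only gives a
  real-linear one.
\<close>

definition holomorphic_several :: "(complex ^ 'n \<Rightarrow> complex) \<Rightarrow> (complex ^ 'n) set \<Rightarrow> bool" where
  "holomorphic_several f Q \<longleftrightarrow>
     (\<forall>z\<in>Q. \<exists>D. (f has_derivative D) (at z) \<and> (\<forall>(c::complex) v. D (c *s v) = c * D v))"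

definition homogeneous_polynomial :: "nat \<Rightarrow> (complex ^ 'n \<Rightarrow> complex) \<Rightarrow> bool" where
  "homogeneous_polynomial k P \<longleftrightarrow>
     (\<exists>c :: ('n \<Rightarrow> nat) \<Rightarrow> complex. \<forall>z.
        P z = (\<Sum>\<alpha> | (\<Sum>i\<in>UNIV. \<alpha> i) = k. c \<alpha> * (\<Prod>i\<in>UNIV. z $ i ^ \<alpha> i)))"

lemma finite_multi_indices: "finite {\<alpha> :: 'n::finite \<Rightarrow> nat. (\<Sum>i\<in>UNIV. \<alpha> i) = k}"
proof (rule finite_subset)
  show "{\<alpha> :: 'n \<Rightarrow> nat. (\<Sum>i\<in>UNIV. \<alpha> i) = k} \<subseteq> (\<Pi>\<^sub>E i\<in>UNIV. {..k})"
    by (auto simp: PiE_def Pi_def intro: member_le_sum)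
  show "finite ((\<Pi>\<^sub>E i\<in>UNIV. {..k}) :: ('n \<Rightarrow> nat) set)"
    by (intro finite_PiE) auto
qed

definition homogeneous_expansion ::
  "(complex ^ 'n \<Rightarrow> complex) \<Rightarrow> (nat \<Rightarrow> complex ^ 'n \<Rightarrow> complex) \<Rightarrow> (complex ^ 'n) set \<Rightarrow> bool" where
  "homogeneous_expansion f P Q \<longleftrightarrow>
     (\<forall>k. homogeneous_polynomial k (P k)) \<and> (\<forall>z\<in>Q. (\<lambda>k. P k z) sums f z)"

definition A_fun :: "real \<Rightarrow> real \<Rightarrow> real \<Rightarrow> real" where
  "A_fun a p r = (1 - (2 - a\<^sup>2) * r) * (1 + a * r) powr p - (1 - r) * (r + a) powr p"

definition min_root :: "real \<Rightarrow> real \<Rightarrow> real" where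
  "min_root a p = (LEAST r. 0 < r \<and> r < 1 \<and> A_fun a p r = 0)"

text \<open>
  The series have nonnegative terms and are summed in \<^typ>\<open>ennreal\<close>, so that a bound
  by 1 includes their convergence.  The coefficient involving \<open>r\<close> is the intended one
  only for \<open>0 \<le> r < 1\<close>.
\<close>

definition bohr_sum ::
  "real \<Rightarrow> real \<Rightarrow> real \<Rightarrow> (complex ^ 'n \<Rightarrow> complex) \<Rightarrow> (nat \<Rightarrow> complex ^ 'n \<Rightarrow> complex)
     \<Rightarrow> complex ^ 'n \<Rightarrow> ennreal" where
  "bohr_sum p a r f P z =
     ennreal (norm (f z) powr p)
     + (\<Sum>k. ennreal (norm (P (Suc k) z)))
     + ennreal (1 / (1 + a) + r / (1 - r)) * (\<Sum>k. ennreal ((norm (P (Suc k) z))\<^sup>2))"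

end

theory Submission
  imports Defs "HOL-Complex_Analysis.Conformal_Mappings"
begin

text \<open>
  Fix \<open>y \<in> Q\<close>.  Along the complex line through \<open>y\<close>, the function becomes a power series
  \<open>g w = f (w y) = \<Sum> c\<^sub>k w\<^sup>k\<close> with \<open>c\<^sub>k = P\<^sub>k y\<close>, bounded by one on a
  neighbourhood of the closed unit disc.  The inequality is a statement about \<open>g\<close> at the point
  \<open>R\<close>, the least root, and it is the sum of two classical estimates.

  The value is bounded by the Schwarz-Pick lemma: \<open>|g R| \<le> (R + a) / (1 + a R)\<close>
  (\<open>schwarz_pick_origin\<close>).

  The two series are bounded together (\<open>coefficient_sums\<close>):
  \<open>\<Sum>|c\<^sub>k| r\<^sup>k + (1/(1+a) + r/(1-r)) \<Sum>|c\<^sub>k|\<^sup>2 r\<^sup>2\<^sup>k \<le> (1 - a\<^sup>2) r / (1 - r)\<close>,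
  both sums starting at \<open>k = 1\<close>.
  This follows from Carlson's inequalities (\<open>carlson_odd\<close>, \<open>carlson_even\<close>), which bound \<open>|c\<^sub>m|\<close> by
  one minus the squares of the coefficients of index at most \<open>m / 2\<close>, the middle one being divided by
  \<open>1 + a\<close> when \<open>m\<close> is even: multiplying by \<open>r\<^sup>m\<close> and summing over \<open>m\<close>, the square
  \<open>|c\<^sub>j|\<^sup>2\<close> collects the factor \<open>r\<^sup>2\<^sup>j/(1+a)\<close> from \<open>m = 2j\<close> and a geometric tail
  from \<open>m > 2j\<close>, together \<open>r\<^sup>2\<^sup>j\<close> times the weight in the inequality.  Carlson's inequalities in turn
  come from the fact that the coefficients of \<open>g F\<^sup>2\<close> are at most the mean of \<open>|F|\<^sup>2\<close> over
  the circle (\<open>norm_fps_nth_mult_square_le\<close>), applied to polynomials \<open>F\<close> made of the coefficients of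
  \<open>g\<close> in reverse order.

  The equation that defines \<open>R\<close> says that the \<open>p\<close>-th power of the first bound and the second bound
  add up to one.

  For sharpness, both estimates are equalities for the disc automorphism \<open>(a - w) / (1 - a w)\<close> at
  \<open>w = -R\<close>.  If \<open>Q\<close> is convex and not the whole space, some linear form maps \<open>Q\<close> onto the unit
  disc (\<open>convex_circular_obtain_functional\<close>), and composing with it transports this function to \<open>Q\<close>.
  The sum is then exactly one at radius \<open>R\<close> and parameter \<open>r = R\<close>, and increasing \<open>r\<close> alone
  pushes it above one.
\<close>

section \<open>Coefficients of power series as integrals over the unit circle\<close>

lemma cis_has_integral:
  fixes k :: int
  shows "((\<lambda>t. cis (of_int k * t)) has_integral (if k = 0 then of_real (2 * pi) else 0)) {0..2*pi}"
proof (cases "k = 0")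
  case True
  have "((\<lambda>t::real. 1 :: complex) has_integral (2*pi - 0) *\<^sub>R 1) {0..2*pi}"
    using has_integral_const_real[of "1::complex" 0 "2*pi"] by simp
  then show ?thesis using True by (simp add: scaleR_conv_of_real)
next
  case False
  define E where "E z = exp (\<i> * of_int k * z) / (\<i> * of_int k)" for z :: complex
  have E: "E (of_real t) = cis (of_int k * t) / (\<i> * of_int k)" for t
    by (simp add: E_def cis_conv_exp mult.assoc)
  have "(E has_field_derivative exp (\<i> * of_int k * z)) (at z)" for z
    unfolding E_def using False by (auto intro!: derivative_eq_intros)
  then have "((\<lambda>t. E (of_real t)) has_vector_derivative cis (of_int k * t)) (at t within {0..2*pi})" for t
    using has_vector_derivative_real_field[of E "exp (\<i> * of_int k * of_real t)" t "{0..2*pi}"]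
    by (simp add: cis_conv_exp mult.assoc)
  then have "((\<lambda>t. cis (of_int k * t)) has_integral (E (of_real (2*pi)) - E (of_real 0))) {0..2*pi}"
    by (intro fundamental_theorem_of_calculus) auto
  moreover have "cis (of_int k * (2*pi)) = 1"
    using cis_multiple_2pi[of "of_int k"] by (simp add: mult_ac)
  ultimately show ?thesis using False by (simp add: E del: of_real_mult of_real_0)
qed

lemma fourier_coefficient_eval_fps:
  fixes H :: "complex fps"
  assumes "fps_conv_radius H > 1"
  shows "((\<lambda>t. eval_fps H (cis t) * cis (- (real m * t))) has_integral of_real (2 * pi) * fps_nth H m)
           {0..2*pi}"
proof -
  define f where "f n t = (\<Sum>k<n. fps_nth H k * cis (of_int (int k - int m) * t))" for n t
  have cis_eq: "cis t ^ k * cis (- (real m * t)) = cis (of_int (int k - int m) * t)" for t k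
    by (simp add: Complex.DeMoivre cis_mult algebra_simps)
  have eval_eq: "eval_fps H (cis t) * cis (- (real m * t))
      = (\<Sum>k. fps_nth H k * cis (of_int (int k - int m) * t))" for t
  proof -
    have "(\<lambda>k. fps_nth H k * cis t ^ k) sums eval_fps H (cis t)"
      using assms by (intro sums_eval_fps) (simp add: one_ereal_def)
    from sums_mult2[OF this, of "cis (- (real m * t))"] show ?thesis
      by (simp only: mult.assoc cis_eq sums_iff)
  qed
  have sm: "summable (\<lambda>k. norm (fps_nth H k))"
    using norm_summable_fps[of 1 H] assms by (simp add: one_ereal_def)
  have unif: "uniform_limit {0..2*pi} f (\<lambda>t. eval_fps H (cis t) * cis (- (real m * t))) sequentially"
    unfolding f_def eval_eq
    by (rule Weierstrass_m_test[OF _ sm]) (simp add: norm_mult)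
  have cont: "continuous_on {0..2*pi} (f n)" for n
    unfolding f_def by (intro continuous_intros)
  obtain I J where I: "\<And>n. (f n has_integral I n) {0..2*pi}"
    and J: "((\<lambda>t. eval_fps H (cis t) * cis (- (real m * t))) has_integral J) {0..2*pi}"
    and lim: "I \<longlonglongrightarrow> J"
    using uniform_limit_integral[OF unif cont] by auto
  have "I n = (\<Sum>k<n. if k = m then of_real (2*pi) * fps_nth H m else 0)" for n
  proof (rule has_integral_unique[OF I])
    have "(f n has_integral (\<Sum>k<n. fps_nth H k * (if int k - int m = 0 then of_real (2*pi) else 0)))
            {0..2*pi}"
      unfolding f_def by (intro has_integral_sum has_integral_mult_right cis_has_integral) auto
    also have "(\<Sum>k<n. fps_nth H k * (if int k - int m = 0 then of_real (2*pi) else 0))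
      = (\<Sum>k<n. if k = m then of_real (2*pi) * fps_nth H m else 0)"
      by (intro sum.cong) auto
    finally show "(f n has_integral (\<Sum>k<n. if k = m then of_real (2*pi) * fps_nth H m else 0)) {0..2*pi}" .
  qed
  then have "eventually (\<lambda>n. I n = of_real (2*pi) * fps_nth H m) sequentially"
    by (auto simp: eventually_sequentially intro!: exI[of _ "Suc m"])
  then have "I \<longlonglongrightarrow> of_real (2*pi) * fps_nth H m"
    by (rule tendsto_eventually)
  with lim J show ?thesis using LIMSEQ_unique by blast
qed

lemma fps_conv_radius_finite_support:
  fixes F :: "complex fps"
  assumes "\<And>j. j \<ge> N \<Longrightarrow> fps_nth F j = 0"
  shows "fps_conv_radius F > 1"
proof -
  have "summable (\<lambda>n. fps_nth F n * 2 ^ n)"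
    by (rule summable_finite[of "{..<N}"]) (use assms in \<open>auto simp: not_less\<close>)
  from conv_radius_geI[OF this] have "fps_conv_radius F \<ge> ereal 2"
    by (simp add: fps_conv_radius_def)
  moreover have "(1::ereal) < ereal 2"
    by simp
  ultimately show ?thesis by (rule less_le_trans[rotated])
qed

lemma parseval_finite_fps:
  fixes F :: "complex fps"
  assumes fin: "\<And>j. j \<ge> N \<Longrightarrow> fps_nth F j = 0"
  shows "((\<lambda>t. (norm (eval_fps F (cis t)))\<^sup>2) has_integral 2 * pi * (\<Sum>j<N. (norm (fps_nth F j))\<^sup>2)) {0..2*pi}"
proof -
  have eval_eq: "eval_fps F z = (\<Sum>j<N. fps_nth F j * z ^ j)" for z
    unfolding eval_fps_def by (rule suminf_finite) (use fin in \<open>auto simp: not_less\<close>)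
  have "((\<lambda>t. \<Sum>j<N. cnj (fps_nth F j) * (eval_fps F (cis t) * cis (- (real j * t)))) has_integral
         (\<Sum>j<N. cnj (fps_nth F j) * (of_real (2*pi) * fps_nth F j))) {0..2*pi}"
    by (intro has_integral_sum has_integral_mult_right fourier_coefficient_eval_fps
        fps_conv_radius_finite_support[of N] fin) auto
  moreover have "(\<Sum>j<N. cnj (fps_nth F j) * (eval_fps F (cis t) * cis (- (real j * t))))
      = of_real ((norm (eval_fps F (cis t)))\<^sup>2)" for t
  proof -
    have "cnj (eval_fps F (cis t)) = (\<Sum>j<N. cnj (fps_nth F j) * cis (- (real j * t)))"
      unfolding eval_eq by (simp add: cis_cnj Complex.DeMoivre)
    then have "(\<Sum>j<N. cnj (fps_nth F j) * (eval_fps F (cis t) * cis (- (real j * t))))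
       = eval_fps F (cis t) * cnj (eval_fps F (cis t))"
      by (simp add: sum_distrib_left mult_ac)
    then show ?thesis by (simp only: complex_norm_square)
  qed
  moreover have "(\<Sum>j<N. cnj (fps_nth F j) * (of_real (2*pi) * fps_nth F j))
      = of_real (2 * pi * (\<Sum>j<N. (norm (fps_nth F j))\<^sup>2))"
    by (simp only: of_real_mult of_real_sum complex_norm_square sum_distrib_left mult_ac)
  ultimately have "((\<lambda>t. complex_of_real ((norm (eval_fps F (cis t)))\<^sup>2)) has_integral
       of_real (2 * pi * (\<Sum>j<N. (norm (fps_nth F j))\<^sup>2))) {0..2*pi}"
    by (simp only:)
  from has_integral_linear[OF this bounded_linear_Re] show ?thesis
    by (simp add: o_def)
qed

text \<open>
  The weight \<open>F\<^sup>2\<close>, rather than \<open>F\<close>, is what makes the bound quadratic in the coefficients of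
  \<open>F\<close>: the coefficient is the mean over the circle of \<open>G F\<^sup>2\<close> times a unimodular factor, and
  \<open>|G F\<^sup>2| \<le> |F|\<^sup>2\<close> there.  A choice of \<open>F\<close> built from the coefficients of \<open>G\<close> itself
  turns this into a nonlinear inequality for them.
\<close>

lemma norm_fps_nth_mult_square_le:
  fixes G F :: "complex fps"
  assumes G: "fps_conv_radius G > 1" and bd: "\<And>z. norm z = 1 \<Longrightarrow> norm (eval_fps G z) \<le> 1"
    and fin: "\<And>j. j \<ge> N \<Longrightarrow> fps_nth F j = 0"
  shows "norm (fps_nth (G * F\<^sup>2) m) \<le> (\<Sum>j<N. (norm (fps_nth F j))\<^sup>2)"
proof -
  let ?H = "G * F\<^sup>2"
  have F: "fps_conv_radius F > 1"
    using fps_conv_radius_finite_support fin by blast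
  have F2: "fps_conv_radius (F\<^sup>2) > 1"
    using fps_conv_radius_power[of F 2] F by (rule less_le_trans[rotated])
  have H: "fps_conv_radius ?H > 1"
    using fps_conv_radius_mult[of G "F\<^sup>2"] G F2 by (meson less_le_trans min_less_iff_conj)
  have eval_eq: "eval_fps ?H z = eval_fps G z * (eval_fps F z)\<^sup>2" if "norm z = 1" for z
    using that G F F2 by (simp add: eval_fps_mult eval_fps_power one_ereal_def)
  note I = fourier_coefficient_eval_fps[OF H, of m]
  note P = parseval_finite_fps[of N F, OF fin]
  have "norm (integral {0..2*pi} (\<lambda>t. eval_fps ?H (cis t) * cis (- (real m * t))))
      \<le> integral {0..2*pi} (\<lambda>t. (norm (eval_fps F (cis t)))\<^sup>2)"
  proof (rule integral_norm_bound_integral)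
    show "norm (eval_fps ?H (cis t) * cis (- (real m * t))) \<le> (norm (eval_fps F (cis t)))\<^sup>2" for t
      using mult_right_mono[OF bd[of "cis t"], of "(norm (eval_fps F (cis t)))\<^sup>2"]
      by (simp add: eval_eq norm_mult norm_power)
  qed (use I P in \<open>auto simp: integrable_on_def\<close>)
  then have "norm (of_real (2*pi) * fps_nth ?H m) \<le> 2 * pi * (\<Sum>j<N. (norm (fps_nth F j))\<^sup>2)"
    using integral_unique[OF I] integral_unique[OF P] by simp
  then show ?thesis by (simp add: norm_mult)
qed

section \<open>Carlson's coefficient inequalities\<close>

text \<open>
  The reversal of the first \<open>L\<close> coefficients makes the coefficient of index \<open>L - 1\<close> of
  \<open>G * reversed_cnj L G\<close> the sum of their squared moduli.
\<close>

definition reversed_cnj :: "nat \<Rightarrow> complex fps \<Rightarrow> complex fps" where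
  "reversed_cnj L G = Abs_fps (\<lambda>j. if j < L then cnj (fps_nth G (L - Suc j)) else 0)"

lemma reversed_cnj_mult_nth:
  "fps_nth (G * reversed_cnj (Suc n) G) n = of_real (\<Sum>j\<le>n. (norm (fps_nth G j))\<^sup>2)"
proof -
  have "fps_nth (G * reversed_cnj (Suc n) G) n = (\<Sum>i=0..n. fps_nth G i * cnj (fps_nth G i))"
    unfolding fps_mult_nth reversed_cnj_def by (intro sum.cong) auto
  then show ?thesis
    by (simp only: of_real_sum complex_norm_square atLeast0AtMost)
qed

lemma sum_norm_reversed_cnj:
  "(\<Sum>j<L. (norm (fps_nth (reversed_cnj L G) j))\<^sup>2) = (\<Sum>j<L. (norm (fps_nth G j))\<^sup>2)"
proof -
  have "(\<Sum>j<L. (norm (fps_nth (reversed_cnj L G) j))\<^sup>2) = (\<Sum>j<L. (norm (fps_nth G (L - Suc j)))\<^sup>2)"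
    by (intro sum.cong) (auto simp: reversed_cnj_def)
  also have "\<dots> = (\<Sum>j<L. (norm (fps_nth G j))\<^sup>2)"
    by (rule sum.nat_diff_reindex)
  finally show ?thesis .
qed

lemma sum_lessThan_split:
  fixes h :: "nat \<Rightarrow> 'a::comm_monoid_add"
  shows "(\<Sum>j<s + L. h j) = (\<Sum>j<s. h j) + (\<Sum>j<L. h (s + j))"
  by (induction L) (auto simp: add.assoc)

lemma obtain_phase:
  fixes c :: complex
  obtains \<omega> where "norm \<omega> = 1" "c = \<omega> * of_real (norm c)"
proof (cases "c = 0")
  case True
  then show ?thesis using that[of 1] by simp
next
  case False
  then show ?thesis by (intro that[of "sgn c"]) (auto simp: norm_sgn sgn_eq norm_divide)
qed

text \<open>
  The test series of Carlson's inequalities are \<open>1\<close> plus shifted series, the shifts \<open>X\<close> and \<open>Y\<close>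
  being powers of the variable.  The two identities are arranged so that each shift stands in front of
  its term and coefficients can be read off.
\<close>

lemma ring_square_one_add:
  fixes G X w q :: "'a::comm_ring_1"
  shows "G * (1 + X * (w * q))\<^sup>2 = G + X * (w * (G * q)) + X * (w * (G * q)) + X * X * ((w * q)\<^sup>2 * G)"
  by (simp add: power2_eq_square algebra_simps)

lemma ring_square_one_add_add:
  fixes G X Y b w q :: "'a::comm_ring_1"
  shows "G * (1 + X * b + Y * (w * q))\<^sup>2
    = G + X * (b * G) + X * (b * G) + X * X * (b * (b * G)) + Y * (w * (G * q)) + Y * (w * (G * q))
      + X * Y * (2 * b * w * (G * q)) + Y * Y * ((w * q)\<^sup>2 * G)"
  by (simp add: power2_eq_square algebra_simps)

text \<open>
  The test series is \<open>F = 1 + \<omega> X\<^sup>n\<^sup>+\<^sup>1 q\<close> with \<open>q\<close> the reversed conjugate of the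
  first \<open>n + 1\<close> coefficients of \<open>G\<close> and \<open>\<omega>\<close> the phase of the coefficient \<open>c\<close> to be
  estimated.  Writing \<open>\<sigma>\<close> for the sum of squares, the coefficient of \<open>G F\<^sup>2\<close> has modulus
  \<open>|c| + 2\<sigma>\<close>, while the squared norm of \<open>F\<close> is \<open>1 + \<sigma>\<close>.
\<close>

lemma carlson_odd:
  fixes G :: "complex fps"
  assumes G: "fps_conv_radius G > 1" and bd: "\<And>z. norm z = 1 \<Longrightarrow> norm (eval_fps G z) \<le> 1"
  shows "norm (fps_nth G (2 * n + 1)) \<le> 1 - (\<Sum>j\<le>n. (norm (fps_nth G j))\<^sup>2)"
proof -
  define c where "c = fps_nth G (2 * n + 1)"
  define \<sigma> where "\<sigma> = (\<Sum>j\<le>n. (norm (fps_nth G j))\<^sup>2)"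
  obtain \<omega> where \<omega>: "norm \<omega> = 1" "c = \<omega> * of_real (norm c)"
    using obtain_phase by blast
  define q where "q = reversed_cnj (Suc n) G"
  define F where "F = 1 + fps_X ^ Suc n * (fps_const \<omega> * q)"
  have F_nth: "fps_nth F j = (if j = 0 then 1 else if j < Suc n then 0 else \<omega> * fps_nth q (j - Suc n))" for j
    by (simp add: F_def fps_X_power_mult_nth del: power_Suc)
  have fin: "fps_nth F j = 0" if "j \<ge> Suc n + Suc n" for j
    using that by (simp add: F_nth q_def reversed_cnj_def)
  have eq: "G * F\<^sup>2 = G + fps_X ^ Suc n * (fps_const \<omega> * (G * q)) + fps_X ^ Suc n * (fps_const \<omega> * (G * q))
      + fps_X ^ (Suc n + Suc n) * ((fps_const \<omega> * q)\<^sup>2 * G)"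
    unfolding F_def power_add by (rule ring_square_one_add)
  have "fps_nth (G * F\<^sup>2) (2 * n + 1) = c + 2 * \<omega> * fps_nth (G * q) n"
    unfolding eq fps_add_nth fps_X_power_mult_nth fps_mult_left_const_nth by (simp add: c_def power2_eq_square)
  also have "\<dots> = \<omega> * of_real (norm c + 2 * \<sigma>)"
    unfolding q_def reversed_cnj_mult_nth \<sigma>_def[symmetric] by (subst \<omega>(2)) (simp add: algebra_simps)
  finally have "norm (fps_nth (G * F\<^sup>2) (2 * n + 1)) = \<bar>norm c + 2 * \<sigma>\<bar>"
    by (simp add: norm_mult \<omega>(1) del: of_real_add of_real_mult)
  moreover have "norm (fps_nth (G * F\<^sup>2) (2 * n + 1)) \<le> (\<Sum>j<Suc n + Suc n. (norm (fps_nth F j))\<^sup>2)"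
    by (rule norm_fps_nth_mult_square_le[OF G bd fin])
  moreover have "(\<Sum>j<Suc n + Suc n. (norm (fps_nth F j))\<^sup>2) = 1 + \<sigma>"
  proof -
    have "(\<Sum>j<Suc n. (norm (fps_nth F j))\<^sup>2) = (\<Sum>j<Suc n. if j = 0 then 1 else 0)"
      by (intro sum.cong) (auto simp: F_nth)
    moreover have "(\<Sum>j<Suc n. (norm (fps_nth F (Suc n + j)))\<^sup>2) = (\<Sum>j<Suc n. (norm (fps_nth q j))\<^sup>2)"
      by (intro sum.cong) (auto simp: F_nth norm_mult \<omega>(1))
    ultimately show ?thesis
      unfolding sum_lessThan_split q_def sum_norm_reversed_cnj \<sigma>_def
      by (simp add: lessThan_Suc_atMost)
  qed
  ultimately show ?thesis unfolding c_def \<sigma>_def by simp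
qed

text \<open>
  Compared with the odd case, the middle coefficient \<open>b = |G\<^sub>n\<^sub>+\<^sub>1|\<close> needs a further term
  \<open>\<beta> X\<^sup>n\<^sup>+\<^sup>1\<close> in the test series, which is now
  \<open>F = 1 + \<beta> X\<^sup>n\<^sup>+\<^sup>1 + \<omega> X\<^sup>n\<^sup>+\<^sup>2 q\<close>.  It contributes \<open>2|\<beta>|b\<close> to the coefficient
  of \<open>G F\<^sup>2\<close> and costs at most \<open>a|\<beta>|\<^sup>2\<close> there, through \<open>\<beta>\<^sup>2 G\<^sub>0\<close>, and
  \<open>|\<beta>|\<^sup>2\<close> in the norm of \<open>F\<close>.  The gain \<open>2|\<beta>|b - (1 + a)|\<beta>|\<^sup>2\<close> is largest for
  \<open>|\<beta>| = b / (1 + a)\<close>.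
\<close>

lemma carlson_even:
  fixes G :: "complex fps"
  assumes G: "fps_conv_radius G > 1" and bd: "\<And>z. norm z = 1 \<Longrightarrow> norm (eval_fps G z) \<le> 1"
  shows "norm (fps_nth G (2 * n + 2)) \<le> 1 - (\<Sum>j\<le>n. (norm (fps_nth G j))\<^sup>2)
            - (norm (fps_nth G (Suc n)))\<^sup>2 / (1 + norm (fps_nth G 0))"
proof -
  define a where "a = norm (fps_nth G 0)"
  define b where "b = norm (fps_nth G (Suc n))"
  define c where "c = fps_nth G (2 * n + 2)"
  define \<sigma> where "\<sigma> = (\<Sum>j\<le>n. (norm (fps_nth G j))\<^sup>2)"
  have a0: "a \<ge> 0" by (simp add: a_def)
  obtain \<omega> where \<omega>: "norm \<omega> = 1" "c = \<omega> * of_real (norm c)"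
    using obtain_phase by blast
  define \<gamma> where "\<gamma> = cnj (fps_nth G (Suc n)) / of_real (1 + a)"
  define \<beta> where "\<beta> = \<omega> * \<gamma>"
  define q where "q = reversed_cnj (Suc n) G"
  define F where "F = 1 + fps_X ^ Suc n * fps_const \<beta> + fps_X ^ Suc (Suc n) * (fps_const \<omega> * q)"
  have F_nth: "fps_nth F j = (if j = 0 then 1 else if j < Suc n then 0 else if j = Suc n then \<beta>
      else \<omega> * fps_nth q (j - Suc (Suc n)))" for j
    by (auto simp add: F_def fps_X_power_mult_nth simp del: power_Suc)
  have fin: "fps_nth F j = 0" if "j \<ge> Suc (Suc n) + Suc n" for j
    using that by (simp add: F_nth q_def reversed_cnj_def)
  have eq: "G * F\<^sup>2 = G + fps_X ^ Suc n * (fps_const \<beta> * G) + fps_X ^ Suc n * (fps_const \<beta> * G)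
      + fps_X ^ (Suc n + Suc n) * (fps_const \<beta> * (fps_const \<beta> * G))
      + fps_X ^ Suc (Suc n) * (fps_const \<omega> * (G * q)) + fps_X ^ Suc (Suc n) * (fps_const \<omega> * (G * q))
      + fps_X ^ (Suc n + Suc (Suc n)) * (2 * fps_const \<beta> * fps_const \<omega> * (G * q))
      + fps_X ^ (Suc (Suc n) + Suc (Suc n)) * ((fps_const \<omega> * q)\<^sup>2 * G)"
    unfolding F_def power_add by (rule ring_square_one_add_add)
  have "fps_nth (G * F\<^sup>2) (2 * n + 2)
      = c + 2 * \<beta> * fps_nth G (Suc n) + \<beta>\<^sup>2 * fps_nth G 0 + 2 * \<omega> * fps_nth (G * q) n"
    unfolding eq fps_add_nth fps_X_power_mult_nth fps_mult_left_const_nth by (simp add: c_def power2_eq_square)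
  also have "\<dots> = \<omega> * (of_real (norm c + 2 * (b\<^sup>2 / (1 + a)) + 2 * \<sigma>) + \<omega> * \<gamma>\<^sup>2 * fps_nth G 0)"
  proof -
    have "\<gamma> * fps_nth G (Suc n) = of_real (b\<^sup>2 / (1 + a))"
      by (simp add: \<gamma>_def b_def complex_norm_square del: of_real_power)
    then have *: "\<beta> * fps_nth G (Suc n) = \<omega> * of_real (b\<^sup>2 / (1 + a))"
      unfolding \<beta>_def mult.assoc by (simp only:)
    have "c + 2 * \<beta> * fps_nth G (Suc n) + \<beta>\<^sup>2 * fps_nth G 0 + 2 * \<omega> * of_real \<sigma>
      = \<omega> * (of_real (norm c) + 2 * of_real (b\<^sup>2 / (1 + a)) + 2 * of_real \<sigma> + \<omega> * \<gamma>\<^sup>2 * fps_nth G 0)"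
      using \<omega>(2) * \<beta>_def by algebra
    then show ?thesis
      unfolding q_def reversed_cnj_mult_nth \<sigma>_def[symmetric]
      by (simp only: of_real_add of_real_mult of_real_numeral)
  qed
  finally have "norm (fps_nth (G * F\<^sup>2) (2 * n + 2))
     = norm (of_real (norm c + 2 * (b\<^sup>2 / (1 + a)) + 2 * \<sigma>) + \<omega> * \<gamma>\<^sup>2 * fps_nth G 0)"
    by (simp add: norm_mult \<omega>(1) del: of_real_add of_real_mult)
  moreover have "norm (of_real (norm c + 2 * (b\<^sup>2 / (1 + a)) + 2 * \<sigma>) + \<omega> * \<gamma>\<^sup>2 * fps_nth G 0)
     \<ge> norm (of_real (norm c + 2 * (b\<^sup>2 / (1 + a)) + 2 * \<sigma>) :: complex) - norm (\<omega> * \<gamma>\<^sup>2 * fps_nth G 0)"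
    by (rule norm_diff_ineq)
  moreover have "norm (of_real (norm c + 2 * (b\<^sup>2 / (1 + a)) + 2 * \<sigma>) :: complex) = \<bar>norm c + 2 * (b\<^sup>2 / (1 + a)) + 2 * \<sigma>\<bar>"
    by (rule norm_of_real)
  moreover have n\<gamma>: "norm \<gamma> = b / (1 + a)"
    using a0 unfolding \<gamma>_def norm_divide norm_of_real b_def by simp
  moreover have "norm (\<omega> * \<gamma>\<^sup>2 * fps_nth G 0) = (b / (1 + a))\<^sup>2 * a"
    by (simp add: norm_mult norm_power \<omega>(1) n\<gamma> a_def)
  moreover have "norm (fps_nth (G * F\<^sup>2) (2 * n + 2)) \<le> (\<Sum>j<Suc (Suc n) + Suc n. (norm (fps_nth F j))\<^sup>2)"
    by (rule norm_fps_nth_mult_square_le[OF G bd fin])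
  moreover have "(\<Sum>j<Suc (Suc n) + Suc n. (norm (fps_nth F j))\<^sup>2) = 1 + (b / (1 + a))\<^sup>2 + \<sigma>"
  proof -
    have "(\<Sum>j<Suc n. (norm (fps_nth F j))\<^sup>2) = (\<Sum>j<Suc n. if j = 0 then 1 else 0)"
      by (intro sum.cong) (auto simp: F_nth)
    then have "(\<Sum>j<Suc (Suc n). (norm (fps_nth F j))\<^sup>2) = 1 + (b / (1 + a))\<^sup>2"
      by (subst sum.lessThan_Suc) (simp add: F_nth \<beta>_def norm_mult \<omega>(1) n\<gamma>)
    moreover have "(\<Sum>j<Suc n. (norm (fps_nth F (Suc (Suc n) + j)))\<^sup>2) = (\<Sum>j<Suc n. (norm (fps_nth q j))\<^sup>2)"
      by (intro sum.cong) (auto simp: F_nth norm_mult \<omega>(1))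
    ultimately show ?thesis
      unfolding sum_lessThan_split q_def sum_norm_reversed_cnj \<sigma>_def
      by (simp add: lessThan_Suc_atMost)
  qed
  ultimately have "norm c + 2 * (b\<^sup>2 / (1 + a)) + 2 * \<sigma> - (b / (1 + a))\<^sup>2 * a \<le> 1 + (b / (1 + a))\<^sup>2 + \<sigma>"
    by linarith
  moreover have "(b / (1 + a))\<^sup>2 * a + (b / (1 + a))\<^sup>2 = b\<^sup>2 / (1 + a)"
    using a0 by (simp add: power2_eq_square divide_simps) (simp add: algebra_simps)
  ultimately have "norm c + b\<^sup>2 / (1 + a) + \<sigma> \<le> 1" by linarith
  then show ?thesis unfolding a_def b_def c_def \<sigma>_def by linarith
qed

section \<open>Sums of moduli and of squared moduli of coefficients\<close>

text \<open>
  One induction step of the next lemma, freed from indices: \<open>x\<close> and \<open>y\<close> are the moduli of the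
  coefficients with indices \<open>2n + 1\<close> and \<open>2n + 2\<close>, \<open>q = r\<^sup>2\<^sup>n\<close>, \<open>S\<close> and \<open>S'\<close>
  are one minus the sums of squares up to \<open>n\<close> and \<open>n + 1\<close>, and \<open>b\<close> is the square that is
  added.  With the bounds on \<open>x\<close> and \<open>y\<close> taken as equalities, the conclusion is an identity,
  and this is where the particular weight \<open>\<kappa>\<close> comes from.
\<close>

lemma coefficient_sums_step:
  fixes S S' b x y \<kappa> a r q :: real
  assumes r: "0 \<le> r" "r < 1" and a: "0 \<le> a" and \<kappa>: "\<kappa> = 1 / (1 + a) + r / (1 - r)"
    and q: "0 \<le> q"
    and x: "x \<le> S" and y: "y \<le> S - b / (1 + a)" and S': "S' = S - b"
  shows "x * (q * r) + y * (q * r\<^sup>2) + \<kappa> * (b * (q * r\<^sup>2)) \<le> S * (q * r) / (1 - r) - S' * (q * r ^ 3) / (1 - r)"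
proof -
  have "x * (q * r) \<le> S * (q * r)" "y * (q * r\<^sup>2) \<le> (S - b / (1 + a)) * (q * r\<^sup>2)"
    using x y q r by (auto intro!: mult_right_mono)
  moreover have "S * (q * r) + (S - b / (1 + a)) * (q * r\<^sup>2) + \<kappa> * (b * (q * r\<^sup>2))
     = S * (q * r) / (1 - r) - S' * (q * r ^ 3) / (1 - r)"
  proof -
    define i j where "i = 1 / (1 - r)" and "j = 1 / (1 + a)"
    have i: "(1 - r) * i = 1" using r by (simp add: i_def)
    have "S * (q * r) + (S - b * j) * (q * r\<^sup>2) + (j + r * i) * (b * (q * r\<^sup>2))
        = S * (q * r) * i - (S - b) * (q * r ^ 3) * i"
      using i by algebra
    then show ?thesis unfolding \<kappa> S' i_def j_def by simp
  qed
  ultimately show ?thesis by linarith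
qed

text \<open>
  The subtracted term is the part of the geometric series not yet spent after \<open>2n\<close> coefficients.
  Keeping it makes the estimate inductive, and avoids rearranging a double series.
\<close>

lemma coefficient_partial_sums:
  fixes G :: "complex fps"
  assumes G: "fps_conv_radius G > 1" and bd: "\<And>z. norm z = 1 \<Longrightarrow> norm (eval_fps G z) \<le> 1"
    and r: "0 \<le> r" "r < 1" and a: "a = norm (fps_nth G 0)" 
    and \<kappa>: "\<kappa> = 1 / (1 + a) + r / (1 - r)"
  shows "(\<Sum>k<2*n. norm (fps_nth G (Suc k)) * r ^ Suc k) + \<kappa> * (\<Sum>k<n. (norm (fps_nth G (Suc k)) * r ^ Suc k)\<^sup>2)
     \<le> (1 - a\<^sup>2) * r / (1 - r) - (1 - (\<Sum>j\<le>n. (norm (fps_nth G j))\<^sup>2)) * r ^ (2 * n + 1) / (1 - r)"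
proof (induction n)
  case 0
  then show ?case by (simp add: a)
next
  case (Suc n)
  let ?S = "\<lambda>n. 1 - (\<Sum>j\<le>n. (norm (fps_nth G j))\<^sup>2)"
  let ?b = "(norm (fps_nth G (Suc n)))\<^sup>2"
  have "norm (fps_nth G (2*n+1)) * (r ^ (2*n) * r) + norm (fps_nth G (2*n+2)) * (r ^ (2*n) * r\<^sup>2)
      + \<kappa> * (?b * (r ^ (2*n) * r\<^sup>2)) \<le> ?S n * (r ^ (2*n) * r) / (1 - r) - ?S (Suc n) * (r ^ (2*n) * r ^ 3) / (1 - r)"
    using carlson_odd[OF G bd, of n] carlson_even[OF G bd, of n] r
    by (intro coefficient_sums_step[OF r _ \<kappa>]) (auto simp: a)
  moreover have "(\<Sum>k<2*Suc n. norm (fps_nth G (Suc k)) * r ^ Suc k)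
    = (\<Sum>k<2*n. norm (fps_nth G (Suc k)) * r ^ Suc k) + norm (fps_nth G (2*n+1)) * (r ^ (2*n) * r)
      + norm (fps_nth G (2*n+2)) * (r ^ (2*n) * r\<^sup>2)"
    by (simp add: power2_eq_square mult_ac)
  moreover have "\<kappa> * (\<Sum>k<Suc n. (norm (fps_nth G (Suc k)) * r ^ Suc k)\<^sup>2)
    = \<kappa> * (\<Sum>k<n. (norm (fps_nth G (Suc k)) * r ^ Suc k)\<^sup>2) + \<kappa> * (?b * (r ^ (2*n) * r\<^sup>2))"
    by (simp add: distrib_left power_mult_distrib power_mult[symmetric] power_add[symmetric] mult.commute)
  moreover have "r ^ (2 * n) * r = r ^ (2 * n + 1)" "r ^ (2*n) * r ^ 3 = r ^ (2 * Suc n + 1)"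
    by (simp_all add: power_add power3_eq_cube)
  ultimately show ?case using Suc.IH by (simp only:)
qed

text \<open>
  Both sums are controlled by the same quantity because each squared coefficient is subtracted from
  Carlson's bounds for all coefficients of at least twice its index; these losses add up to exactly
  the weighted second sum.
\<close>

lemma coefficient_sums:
  fixes G :: "complex fps"
  assumes G: "fps_conv_radius G > 1" and bd: "\<And>z. norm z = 1 \<Longrightarrow> norm (eval_fps G z) \<le> 1"
    and r: "0 \<le> r" "r < 1" and a: "a = norm (fps_nth G 0)"
  shows "summable (\<lambda>k. norm (fps_nth G (Suc k)) * r ^ Suc k)"
    and "summable (\<lambda>k. (norm (fps_nth G (Suc k)) * r ^ Suc k)\<^sup>2)"
    and "(\<Sum>k. norm (fps_nth G (Suc k)) * r ^ Suc k)
       + (1 / (1 + a) + r / (1 - r)) * (\<Sum>k. (norm (fps_nth G (Suc k)) * r ^ Suc k)\<^sup>2)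
       \<le> (1 - a\<^sup>2) * r / (1 - r)"
proof -
  let ?u = "\<lambda>k. norm (fps_nth G (Suc k)) * r ^ Suc k"
  define \<kappa> where "\<kappa> = 1 / (1 + a) + r / (1 - r)"
  have G': "ereal (norm (of_real r :: complex)) < fps_conv_radius G"
  proof -
    have "ereal (norm (of_real r :: complex)) < 1" using r by (simp add: one_ereal_def)
    then show ?thesis using G by (rule less_trans)
  qed
  have "summable (\<lambda>k. norm (fps_nth G k) * r ^ k)"
    using norm_summable_fps[OF G'] r by (simp add: norm_mult norm_power)
  then show s1: "summable ?u" by (subst summable_Suc_iff)
  have u0: "?u k \<ge> 0" for k using r by simp
  \<comment> \<open>The terms are eventually below one, so their squares are dominated by them.\<close>
  have "(\<lambda>k. ?u k) \<longlonglongrightarrow> 0" using s1 by (rule summable_LIMSEQ_zero)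
  then have "eventually (\<lambda>k. ?u k < 1) sequentially" by (rule order_tendstoD) simp
  then show s2: "summable (\<lambda>k. (?u k)\<^sup>2)"
  proof (intro summable_comparison_test_ev[OF _ s1], eventually_elim)
    case (elim k)
    then show ?case using mult_left_mono[of "?u k" 1 "?u k"] u0[of k] by (simp add: power2_eq_square)
  qed
  have "(\<lambda>n. (\<Sum>k<2*n. ?u k) + \<kappa> * (\<Sum>k<n. (?u k)\<^sup>2)) \<longlonglongrightarrow> (\<Sum>k. ?u k) + \<kappa> * (\<Sum>k. (?u k)\<^sup>2)"
  proof (intro tendsto_intros summable_LIMSEQ[OF s2])
    show "(\<lambda>n. \<Sum>k<2*n. ?u k) \<longlonglongrightarrow> (\<Sum>k. ?u k)"
      using LIMSEQ_subseq_LIMSEQ[OF summable_LIMSEQ[OF s1], of "\<lambda>n. 2 * n"]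
      by (simp add: o_def strict_mono_def)
  qed
  moreover have "(\<Sum>k<2*n. ?u k) + \<kappa> * (\<Sum>k<n. (?u k)\<^sup>2) \<le> (1 - a\<^sup>2) * r / (1 - r)" for n
  proof -
    have "0 \<le> 1 - (\<Sum>j\<le>n. (norm (fps_nth G j))\<^sup>2)"
      using carlson_odd[OF G bd, of n] norm_ge_zero[of "fps_nth G (2*n+1)"] by linarith
    then have "0 \<le> (1 - (\<Sum>j\<le>n. (norm (fps_nth G j))\<^sup>2)) * r ^ (2 * n + 1) / (1 - r)"
      using r by simp
    then show ?thesis using coefficient_partial_sums[OF G bd r a \<kappa>_def, of n] by linarith
  qed
  ultimately show "(\<Sum>k. ?u k) + (1 / (1 + a) + r / (1 - r)) * (\<Sum>k. (?u k)\<^sup>2) \<le> (1 - a\<^sup>2) * r / (1 - r)"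
    unfolding \<kappa>_def[symmetric] by (intro LIMSEQ_le_const2) auto
qed

section \<open>The Schwarz-Pick estimate at the origin\<close>

lemma norm_one_minus_cnj_mult_sq:
  fixes \<alpha> w :: complex
  shows "(norm (1 - cnj \<alpha> * w))\<^sup>2 = (norm (w - \<alpha>))\<^sup>2 + (1 - (norm \<alpha>)\<^sup>2) * (1 - (norm w)\<^sup>2)"
  unfolding cmod_power2 by (simp, algebra)

lemma norm_moebius_less_one:
  fixes \<alpha> w :: complex
  assumes "norm \<alpha> < 1" "norm w < 1"
  shows "norm ((w - \<alpha>) / (1 - cnj \<alpha> * w)) < 1"
proof -
  have "0 < (1 - (norm \<alpha>)\<^sup>2) * (1 - (norm w)\<^sup>2)"
    using assms by (simp add: power_less_one_iff abs_square_less_1)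
  then have "(norm (w - \<alpha>))\<^sup>2 < (norm (1 - cnj \<alpha> * w))\<^sup>2"
    unfolding norm_one_minus_cnj_mult_sq by simp
  then have "norm (w - \<alpha>) < norm (1 - cnj \<alpha> * w)"
    by (rule power_less_imp_less_base) simp
  then show ?thesis
    using le_less_trans[OF norm_ge_zero] by (simp add: norm_divide divide_less_eq_1)
qed

text \<open>
  The Schwarz lemma applies to \<open>g\<close> followed by the disc automorphism that sends \<open>g 0\<close> to \<open>0\<close>.
  The real bound is then extracted by comparing squares with the identity above.
\<close>

lemma schwarz_pick_origin:
  fixes g :: "complex \<Rightarrow> complex"
  assumes hol: "g holomorphic_on ball 0 1" and bd: "\<And>z. norm z < 1 \<Longrightarrow> norm (g z) < 1"
    and z: "norm z < 1"
  shows "norm (g z) \<le> (norm z + norm (g 0)) / (1 + norm (g 0) * norm z)"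
proof -
  define \<alpha> where "\<alpha> = g 0"
  define h where "h z = (g z - \<alpha>) / (1 - cnj \<alpha> * g z)" for z
  define x where "x = norm (g z)"
  define a where "a = norm \<alpha>"
  define r where "r = norm z"
  have a1: "a < 1" "0 \<le> a" using bd[of 0] by (simp_all add: a_def \<alpha>_def)
  have x1: "x < 1" "0 \<le> x" using bd[OF z] by (simp_all add: x_def)
  have ax: "a * x < 1" using a1 x1 mult_left_mono[of x 1 a] by simp
  have nz: "1 - cnj \<alpha> * g w \<noteq> 0" if "norm w < 1" for w
  proof
    assume "1 - cnj \<alpha> * g w = 0"
    then have "norm (cnj \<alpha> * g w) = 1" by simp
    moreover have "norm (cnj \<alpha> * g w) < 1"
      using a1 bd[OF that] mult_strict_mono'[of a 1 "norm (g w)" 1] by (simp add: norm_mult a_def)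
    ultimately show False by simp
  qed
  have "h holomorphic_on ball 0 1"
    unfolding h_def using nz by (intro holomorphic_intros hol) auto
  moreover have "norm (h w) < 1" if "norm w < 1" for w
    unfolding h_def using a1 bd[OF that] by (intro norm_moebius_less_one) (auto simp: a_def)
  moreover have "h 0 = 0" by (simp add: h_def \<alpha>_def)
  ultimately have "norm (h z) \<le> r"
    unfolding r_def using z by (intro Schwarz_Lemma(1))
  then have "norm (g z - \<alpha>) \<le> r * norm (1 - cnj \<alpha> * g z)"
    using nz[OF z] by (simp add: h_def norm_divide divide_simps)
  then have "(norm (g z - \<alpha>))\<^sup>2 \<le> r\<^sup>2 * (norm (1 - cnj \<alpha> * g z))\<^sup>2"
    unfolding power_mult_distrib[symmetric] by (intro power_mono) simp_all
  then have "(1 - r\<^sup>2) * (norm (1 - cnj \<alpha> * g z))\<^sup>2 \<le> (1 - a\<^sup>2) * (1 - x\<^sup>2)"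
    using norm_one_minus_cnj_mult_sq[of \<alpha> "g z"] unfolding a_def x_def left_diff_distrib[of 1 "r\<^sup>2"]
    by linarith
  moreover have "(1 - r\<^sup>2) * (1 - a * x)\<^sup>2 \<le> (1 - r\<^sup>2) * (norm (1 - cnj \<alpha> * g z))\<^sup>2"
  proof (intro mult_left_mono power_mono)
    show "1 - a * x \<le> norm (1 - cnj \<alpha> * g z)"
      using norm_triangle_ineq2[of 1 "cnj \<alpha> * g z"] by (simp add: norm_mult a_def x_def)
    show "0 \<le> 1 - r\<^sup>2" using z by (simp add: r_def power_le_one)
  qed (use ax in auto)
  \<comment> \<open>The real case of the identity: \<open>(1 - a x)\<^sup>2 - (x - a)\<^sup>2 = (1 - a\<^sup>2) (1 - x\<^sup>2)\<close>.\<close>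
  ultimately have "(x - a)\<^sup>2 \<le> (r * (1 - a * x))\<^sup>2"
    by (simp add: power2_eq_square algebra_simps)
  then have "x - a \<le> r * (1 - a * x)"
    by (rule power2_le_imp_le) (use ax in \<open>simp add: r_def\<close>)
  then have "x * (1 + a * r) \<le> r + a" by (simp add: algebra_simps)
  moreover have "0 < 1 + a * r" using a1 by (simp add: r_def add_pos_nonneg)
  ultimately show ?thesis
    by (simp add: pos_le_divide_eq x_def a_def r_def \<alpha>_def)
qed

section \<open>The least root\<close>

text \<open>
  The defining function is positive at \<open>0\<close> and negative at \<open>1\<close>, so its zero set in the unit
  interval is nonempty, compact and disjoint from the end points.  Hence the least zero is attained.
\<close>

lemma min_root_is_root:
  assumes a: "0 \<le> a" "a < 1" and p: "0 < p"
  shows "0 < min_root a p" "min_root a p < 1" "A_fun a p (min_root a p) = 0"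
proof -
  have A0: "A_fun a p 0 > 0"
    using a p powr_less_mono2[of p a 1] by (cases "a = 0") (auto simp: A_fun_def)
  have A1: "A_fun a p 1 < 0"
    using a by (simp add: A_fun_def mult_less_0_iff power_less_one_iff abs_square_less_1)
  have cont: "continuous_on {0..1} (A_fun a p)"
    unfolding A_fun_def
    by (intro continuous_intros continuous_on_powr') (use a p in \<open>auto intro: add_nonneg_nonneg\<close>)
  let ?Z = "{r \<in> {0..1}. A_fun a p r = 0}"
  have "closed ?Z"
    by (rule continuous_closed_preimage_constant[OF cont]) simp
  moreover have "bounded ?Z"
    by (rule bounded_subset[of "{0..1}"]) auto
  ultimately have "compact ?Z"
    by (simp only: compact_eq_bounded_closed)
  moreover obtain x where "0 \<le> x" "x \<le> 1" "A_fun a p x = 0"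
    using IVT2'[of "A_fun a p" 1 0 0] A0 A1 cont by auto
  then have "?Z \<noteq> {}" by auto
  ultimately obtain s where "s \<in> ?Z" "\<forall>r\<in>?Z. s \<le> r"
    using compact_attains_inf by blast
  then have s: "s \<in> {0..1}" "A_fun a p s = 0"
    "\<And>r. r \<in> {0..1} \<Longrightarrow> A_fun a p r = 0 \<Longrightarrow> s \<le> r"
    by auto
  have s01: "0 < s" "s < 1"
    using s A0 A1 by (auto simp: less_le)
  have "min_root a p = s"
    unfolding min_root_def by (rule Least_equality) (use s s01 in auto)
  then show "0 < min_root a p" "min_root a p < 1" "A_fun a p (min_root a p) = 0"
    using s s01 by auto
qed

text \<open>
  The summands are the Schwarz-Pick bound for the value and the bound from \<open>coefficient_sums\<close> for
  the two series; the root is the radius at which they add up to one.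
\<close>

lemma A_fun_root_equation:
  assumes a: "0 \<le> a" and r: "0 \<le> r" "r < 1" and A: "A_fun a p r = 0"
  shows "((r + a) / (1 + a * r)) powr p + (1 - a\<^sup>2) * r / (1 - r) = 1"
proof -
  define X Y where "X = (1 + a * r) powr p" and "Y = (r + a) powr p"
  have "1 + a * r > 0" using a r by (simp add: add_pos_nonneg)
  then have X: "X > 0" by (simp add: X_def)
  have "((r + a) / (1 + a * r)) powr p = Y / X"
    using a r by (simp add: powr_divide X_def Y_def)
  moreover have "(1 - (2 - a\<^sup>2) * r) * X = (1 - r) * Y"
    using A by (simp add: A_fun_def X_def Y_def)
  then have "Y / X = (1 - (2 - a\<^sup>2) * r) / (1 - r)"
    using X r by (simp add: field_simps)
  moreover have "(1 - (2 - a\<^sup>2) * r) / (1 - r) + (1 - a\<^sup>2) * r / (1 - r) = 1"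
    using r by (simp add: add_divide_distrib[symmetric] algebra_simps)
  ultimately show ?thesis by simp
qed

section \<open>Restriction to complex lines through the origin\<close>

lemma bohr_sum_eq_ennreal:
  assumes "summable (\<lambda>k. norm (P (Suc k) z))" "summable (\<lambda>k. (norm (P (Suc k) z))\<^sup>2)"
    and "0 \<le> 1 / (1 + a) + r / (1 - r)"
  shows "bohr_sum p a r f P z = ennreal (norm (f z) powr p + (\<Sum>k. norm (P (Suc k) z))
     + (1 / (1 + a) + r / (1 - r)) * (\<Sum>k. (norm (P (Suc k) z))\<^sup>2))"
proof -
  have "(\<Sum>k. ennreal (norm (P (Suc k) z))) = ennreal (\<Sum>k. norm (P (Suc k) z))"
    by (rule suminf_ennreal2[OF _ assms(1)]) simp
  moreover have "(\<Sum>k. ennreal ((norm (P (Suc k) z))\<^sup>2)) = ennreal (\<Sum>k. (norm (P (Suc k) z))\<^sup>2)"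
    by (rule suminf_ennreal2[OF _ assms(2)]) simp
  moreover have "0 \<le> (\<Sum>k. norm (P (Suc k) z))" "0 \<le> (\<Sum>k. (norm (P (Suc k) z))\<^sup>2)"
    using assms(1,2) by (auto intro: suminf_nonneg)
  ultimately show ?thesis
    unfolding bohr_sum_def
    by (simp only: ennreal_mult[OF assms(3), symmetric] ennreal_plus[symmetric]
        add_nonneg_nonneg mult_nonneg_nonneg powr_ge_zero assms(3))
qed

lemma homogeneous_polynomial_scale:
  fixes P :: "complex ^ 'n \<Rightarrow> complex"
  assumes "homogeneous_polynomial k P"
  shows "P (c *s z) = c ^ k * P z"
proof -
  obtain b where b: "\<And>z. P z = (\<Sum>\<alpha> | (\<Sum>i\<in>UNIV. \<alpha> i) = k. b \<alpha> * (\<Prod>i\<in>UNIV. z $ i ^ \<alpha> i))"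
    using assms unfolding homogeneous_polynomial_def by blast
  have "P (c *s z) = (\<Sum>\<alpha> | (\<Sum>i\<in>UNIV. \<alpha> i) = k. c ^ k * (b \<alpha> * (\<Prod>i\<in>UNIV. z $ i ^ \<alpha> i)))"
    unfolding b by (intro sum.cong) (auto simp: power_mult_distrib prod.distrib power_sum)
  then show ?thesis by (simp add: b sum_distrib_left)
qed

lemma scaleR_eq_vector_smult: "r *\<^sub>R (z :: complex ^ 'n) = of_real r *s z"
proof (unfold vec_eq_iff, intro allI)
  fix i
  have "(r *\<^sub>R z) $ i = r *\<^sub>R (z $ i)" by (rule vector_scaleR_component)
  also have "\<dots> = (of_real r *s z) $ i"
    by (simp only: vector_smult_component scaleR_conv_of_real)
  finally show "(r *\<^sub>R z) $ i = (of_real r *s z) $ i" .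
qed

lemma open_obtain_dilation:
  fixes z :: "complex ^ 'n"
  assumes "open Q" "z \<in> Q"
  obtains s :: real where "1 < s" "of_real s *s z \<in> Q"
proof -
  have "((\<lambda>s. s *\<^sub>R z) \<longlongrightarrow> 1 *\<^sub>R z) (at_right 1)"
    by (intro tendsto_intros)
  then have "eventually (\<lambda>s. s *\<^sub>R z \<in> Q) (at_right 1)"
    using assms by (intro topological_tendstoD) auto
  moreover have "eventually (\<lambda>s::real. 1 < s) (at_right 1)"
    by (rule eventually_at_right_less)
  ultimately have "eventually (\<lambda>s. 1 < s \<and> s *\<^sub>R z \<in> Q) (at_right 1)"
    by eventually_elim simp
  then obtain s where "1 < s" "s *\<^sub>R z \<in> Q"
    using eventually_happens'[OF trivial_limit_at_right_real] by blast
  then show ?thesis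
    using that[of s] unfolding scaleR_eq_vector_smult by blast
qed

text \<open>
  The power series, in the complex variable \<open>w\<close>, of \<open>f (w *s z)\<close> when \<open>P\<close> is the homogeneous
  expansion of \<open>f\<close>.
\<close>

definition slice :: "(nat \<Rightarrow> complex ^ 'n \<Rightarrow> complex) \<Rightarrow> complex ^ 'n \<Rightarrow> complex fps" where
  "slice P z = Abs_fps (\<lambda>k. P k z)"

lemma slice_nth [simp]: "fps_nth (slice P z) k = P k z"
  by (simp add: slice_def)

text \<open>
  As \<open>Q\<close> is open, it contains a slight dilation of \<open>z\<close>, and this pushes the radius of convergence
  strictly beyond one.
\<close>

lemma slice_properties:
  fixes P :: "nat \<Rightarrow> complex ^ 'n \<Rightarrow> complex"
  assumes Q: "complete_circular_domain Q" and P: "homogeneous_expansion f P Q" and z: "z \<in> Q"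
  shows "fps_conv_radius (slice P z) > 1"
    and "\<And>w. norm w \<le> 1 \<Longrightarrow> eval_fps (slice P z) w = f (w *s z)"
proof -
  have scale: "P k (w *s y) = w ^ k * P k y" for k w y
    using P homogeneous_polynomial_scale unfolding homogeneous_expansion_def by blast
  have sums: "(\<lambda>k. P k y) sums f y" if "y \<in> Q" for y
    using P that unfolding homogeneous_expansion_def by blast
  have "open Q" using Q by (simp add: complete_circular_domain_def)
  then obtain s where s: "1 < s" "of_real s *s z \<in> Q"
    using open_obtain_dilation z by blast
  have "summable (\<lambda>k. P k z * of_real s ^ k)"
    using sums[OF s(2)] by (simp add: scale mult.commute sums_iff)
  from conv_radius_geI[OF this] have "fps_conv_radius (slice P z) \<ge> ereal s"
    using s by (simp add: fps_conv_radius_def slice_def)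
  moreover have "(1::ereal) < ereal s" using s by (simp add: one_ereal_def)
  ultimately show "fps_conv_radius (slice P z) > 1" by (rule less_le_trans[rotated])
  show "eval_fps (slice P z) w = f (w *s z)" if "norm w \<le> 1" for w
  proof -
    have "w *s z \<in> Q" using Q z that by (simp add: complete_circular_domain_def)
    from sums[OF this] show ?thesis by (simp add: eval_fps_def scale mult.commute sums_iff)
  qed
qed

text \<open>
  For \<open>z = R y\<close> with \<open>y \<in> Q\<close>, everything takes place in the slice through \<open>y\<close> at the
  point \<open>R\<close>.  The weight increases with \<open>r\<close>, so \<open>r = R\<close> is the worst case.
\<close>

lemma bohr_inequality:
  fixes Q :: "(complex ^ 'n) set"
  assumes Q: "complete_circular_domain Q" and p: "p > 0" and P: "homogeneous_expansion f P Q"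
    and bd: "\<And>w. w \<in> Q \<Longrightarrow> norm (f w) < 1" and a: "a = norm (f 0)"
    and z: "z \<in> homothetic (min_root a p) Q" and r: "0 \<le> r" "r \<le> min_root a p"
  shows "bohr_sum p a r f P z \<le> 1"
proof -
  define R where "R = min_root a p"
  have 0: "0 \<in> Q" using Q by (simp add: complete_circular_domain_def)
  have a01: "0 \<le> a" "a < 1" using a bd[OF 0] by auto
  have R: "0 < R" "R < 1" "A_fun a p R = 0" using min_root_is_root[OF a01 p] by (auto simp: R_def)
  obtain y where y: "y \<in> Q" "z = of_real R *s y"
    using z by (auto simp: homothetic_def R_def scaleR_eq_vector_smult)
  define G where "G = slice P y"
  have rad: "fps_conv_radius G > 1" and eval_eq: "\<And>w. norm w \<le> 1 \<Longrightarrow> eval_fps G w = f (w *s y)"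
    using slice_properties[OF Q P y(1)] by (simp_all add: G_def)
  have bdG: "norm (eval_fps G w) < 1" if "norm w \<le> 1" for w
  proof -
    have "w *s y \<in> Q" using Q y(1) that by (simp add: complete_circular_domain_def)
    then show ?thesis using bd eval_eq[OF that] by simp
  qed
  have G0: "eval_fps G 0 = f 0" using eval_eq[of 0] by simp
  then have aG: "a = norm (fps_nth G 0)" by (simp add: eval_fps_at_0 a)
  have hol: "eval_fps G holomorphic_on ball 0 1"
  proof (intro holomorphic_on_eval_fps)
    show "ball 0 1 \<subseteq> eball 0 (fps_conv_radius G)"
      using rad by (intro ball_eball_mono) (simp add: one_ereal_def)
  qed
  have "norm (eval_fps G (of_real R)) \<le> (R + a) / (1 + a * R)"
  proof -
    have "norm (eval_fps G w) < 1" if "norm w < 1" for w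
      using bdG that by simp
    moreover have "norm (of_real R :: complex) = R" using R(1) by simp
    ultimately show ?thesis
      using schwarz_pick_origin[OF hol, of "of_real R"] R(2) unfolding G0 a by simp
  qed
  then have "norm (f z) \<le> (R + a) / (1 + a * R)"
    using eval_eq[of "of_real R"] R(1,2) unfolding y(2) by simp
  then have fz: "norm (f z) powr p \<le> ((R + a) / (1 + a * R)) powr p"
    using p by (intro powr_mono2) auto
  have Pz: "norm (P (Suc k) z) = norm (fps_nth G (Suc k)) * R ^ Suc k" for k
  proof -
    have "P (Suc k) z = of_real R ^ Suc k * P (Suc k) y"
      using P homogeneous_polynomial_scale unfolding homogeneous_expansion_def y(2) by blast
    then show ?thesis using R by (simp add: norm_mult norm_power G_def del: power_Suc)
  qed
  have bdc: "norm (eval_fps G w) \<le> 1" if "norm w = 1" for w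
    using bdG[of w] that by simp
  let ?u = "\<lambda>k. norm (fps_nth G (Suc k)) * R ^ Suc k"
  have u1: "summable ?u"
    by (rule coefficient_sums(1)[OF rad _ less_imp_le[OF R(1)] R(2) aG]) (rule bdc)
  have u2: "summable (\<lambda>k. (?u k)\<^sup>2)"
    by (rule coefficient_sums(2)[OF rad _ less_imp_le[OF R(1)] R(2) aG]) (rule bdc)
  have u3: "(\<Sum>k. ?u k) + (1 / (1 + a) + R / (1 - R)) * (\<Sum>k. (?u k)\<^sup>2)
      \<le> (1 - a\<^sup>2) * R / (1 - R)"
    by (rule coefficient_sums(3)[OF rad _ less_imp_le[OF R(1)] R(2) aG]) (rule bdc)
  have cs: "summable (\<lambda>k. norm (P (Suc k) z))" "summable (\<lambda>k. (norm (P (Suc k) z))\<^sup>2)"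
    "(\<Sum>k. norm (P (Suc k) z)) + (1 / (1 + a) + R / (1 - R)) * (\<Sum>k. (norm (P (Suc k) z))\<^sup>2)
      \<le> (1 - a\<^sup>2) * R / (1 - R)"
    using u1 u2 u3 by (simp_all only: Pz)
  have "r / (1 - r) \<le> R / (1 - R)"
    using r R by (intro frac_le) (auto simp: R_def)
  then have "1 / (1 + a) + r / (1 - r) \<le> 1 / (1 + a) + R / (1 - R)"
    by simp
  then have "(1 / (1 + a) + r / (1 - r)) * (\<Sum>k. (norm (P (Suc k) z))\<^sup>2)
     \<le> (1 / (1 + a) + R / (1 - R)) * (\<Sum>k. (norm (P (Suc k) z))\<^sup>2)"
    by (intro mult_right_mono suminf_nonneg cs(2)) simp_all
  then have "norm (f z) powr p + (\<Sum>k. norm (P (Suc k) z))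
     + (1 / (1 + a) + r / (1 - r)) * (\<Sum>k. (norm (P (Suc k) z))\<^sup>2)
     \<le> norm (f z) powr p + ((\<Sum>k. norm (P (Suc k) z))
     + (1 / (1 + a) + R / (1 - R)) * (\<Sum>k. (norm (P (Suc k) z))\<^sup>2))"
    unfolding add.assoc by (intro add_left_mono)
  also have "\<dots> \<le> ((R + a) / (1 + a * R)) powr p + (1 - a\<^sup>2) * R / (1 - R)"
    by (rule add_mono[OF fz cs(3)])
  also have "\<dots> = 1"
    by (rule A_fun_root_equation[OF a01(1) less_imp_le[OF R(1)] R(2,3)])
  finally have "norm (f z) powr p + (\<Sum>k. norm (P (Suc k) z))
     + (1 / (1 + a) + r / (1 - r)) * (\<Sum>k. (norm (P (Suc k) z))\<^sup>2) \<le> 1" .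
  moreover have "0 \<le> 1 / (1 + a) + r / (1 - r)"
    using r R(2) a01 unfolding R_def[symmetric] by (intro add_nonneg_nonneg divide_nonneg_nonneg) linarith+
  ultimately show ?thesis
    using bohr_sum_eq_ennreal[where P = P and z = z, OF cs(1,2)] by (simp only: ennreal_le_1)
qed

section \<open>Powers of linear forms are homogeneous polynomials\<close>

text \<open>
  Multiplication by a coordinate shifts multi-indices injectively; the multi-indices that are not hit
  are those without this coordinate, which receive the coefficient zero.
\<close>

lemma homogeneous_polynomial_coordinate_mult:
  fixes P :: "complex ^ 'n \<Rightarrow> complex"
  assumes "homogeneous_polynomial k P"
  shows "homogeneous_polynomial (Suc k) (\<lambda>z. z $ i * P z)"
proof -
  obtain b where b: "\<And>z. P z = (\<Sum>\<alpha> | (\<Sum>i\<in>UNIV. \<alpha> i) = k. b \<alpha> * (\<Prod>i\<in>UNIV. z $ i ^ \<alpha> i))"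
    using assms unfolding homogeneous_polynomial_def by blast
  define A where "A = {\<alpha> :: 'n \<Rightarrow> nat. (\<Sum>i\<in>UNIV. \<alpha> i) = k}"
  define B where "B = {\<alpha> :: 'n \<Rightarrow> nat. (\<Sum>i\<in>UNIV. \<alpha> i) = Suc k}"
  define up where "up \<alpha> = \<alpha>(i := Suc (\<alpha> i))" for \<alpha> :: "'n \<Rightarrow> nat"
  define c where "c \<beta> = (if \<beta> i = 0 then 0 else b (\<beta>(i := \<beta> i - 1)))" for \<beta> :: "'n \<Rightarrow> nat"
  have sum_up: "sum (up \<alpha>) UNIV = Suc (sum \<alpha> UNIV)" for \<alpha>
    by (simp add: up_def sum.remove[of UNIV i])
  have prod_up: "(\<Prod>j\<in>UNIV. z $ j ^ up \<alpha> j) = z $ i * (\<Prod>j\<in>UNIV. z $ j ^ \<alpha> j)" for z :: "complex ^ 'n" and \<alpha>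
    by (simp add: up_def prod.remove[of UNIV i] mult.assoc)
  have inj: "inj_on up A"
  proof (rule inj_onI)
    fix \<alpha> \<beta> assume "up \<alpha> = up \<beta>"
    then have eq: "up \<alpha> j = up \<beta> j" for j by simp
    have "\<alpha> j = \<beta> j" for j
      using eq[of j] by (cases "j = i") (simp_all add: up_def)
    then show "\<alpha> = \<beta>" by blast
  qed
  have image: "up ` A = {\<beta> \<in> B. \<beta> i \<noteq> 0}"
  proof (intro set_eqI iffI)
    fix \<beta> assume "\<beta> \<in> {\<beta> \<in> B. \<beta> i \<noteq> 0}"
    then have "\<beta> = up (\<beta>(i := \<beta> i - 1))" "sum \<beta> UNIV = Suc k"
      by (auto simp: up_def B_def)
    then show "\<beta> \<in> up ` A"
      using sum_up[of "\<beta>(i := \<beta> i - 1)"] by (auto simp: A_def)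
  qed (auto simp: A_def B_def sum_up, simp add: up_def)
  have "z $ i * P z = (\<Sum>\<beta>\<in>B. c \<beta> * (\<Prod>j\<in>UNIV. z $ j ^ \<beta> j))" for z
  proof -
    have "z $ i * P z = (\<Sum>\<alpha>\<in>A. c (up \<alpha>) * (\<Prod>j\<in>UNIV. z $ j ^ up \<alpha> j))"
      unfolding b A_def[symmetric] sum_distrib_left prod_up
      by (intro sum.cong) (auto simp: c_def up_def)
    also have "\<dots> = (\<Sum>\<beta>\<in>up ` A. c \<beta> * (\<Prod>j\<in>UNIV. z $ j ^ \<beta> j))"
      by (simp add: sum.reindex[OF inj])
    also have "\<dots> = (\<Sum>\<beta>\<in>B. c \<beta> * (\<Prod>j\<in>UNIV. z $ j ^ \<beta> j))"
      unfolding image B_def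
      by (intro sum.mono_neutral_left finite_multi_indices) (auto simp: c_def)
    finally show ?thesis .
  qed
  then show ?thesis unfolding homogeneous_polynomial_def B_def by blast
qed

lemma homogeneous_polynomial_sum:
  fixes P :: "'a \<Rightarrow> complex ^ 'n \<Rightarrow> complex"
  assumes "\<And>i. i \<in> I \<Longrightarrow> homogeneous_polynomial k (P i)"
  shows "homogeneous_polynomial k (\<lambda>z. \<Sum>i\<in>I. c i * P i z)"
proof -
  have "\<forall>i\<in>I. \<exists>b. \<forall>z. P i z = (\<Sum>\<alpha> | (\<Sum>i\<in>UNIV. \<alpha> i) = k. b \<alpha> * (\<Prod>i\<in>UNIV. z $ i ^ \<alpha> i))"
    using assms unfolding homogeneous_polynomial_def by blast
  then obtain b where b: "\<And>i z. i \<in> I \<Longrightarrow>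
      P i z = (\<Sum>\<alpha> | (\<Sum>i\<in>UNIV. \<alpha> i) = k. b i \<alpha> * (\<Prod>i\<in>UNIV. z $ i ^ \<alpha> i))"
    by metis
  have "(\<Sum>i\<in>I. c i * P i z) = (\<Sum>\<alpha> | (\<Sum>i\<in>UNIV. \<alpha> i) = k. (\<Sum>i\<in>I. c i * b i \<alpha>) * (\<Prod>i\<in>UNIV. z $ i ^ \<alpha> i))"
    for z
  proof -
    have "(\<Sum>i\<in>I. c i * P i z)
       = (\<Sum>i\<in>I. \<Sum>\<alpha> | (\<Sum>i\<in>UNIV. \<alpha> i) = k. c i * b i \<alpha> * (\<Prod>i\<in>UNIV. z $ i ^ \<alpha> i))"
      by (intro sum.cong) (simp_all add: b sum_distrib_left mult.assoc)
    then show ?thesis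
      by (subst (asm) sum.swap) (simp add: sum_distrib_right)
  qed
  then show ?thesis unfolding homogeneous_polynomial_def by (intro exI[of _ "\<lambda>\<alpha>. \<Sum>i\<in>I. c i * b i \<alpha>"]) blast
qed

lemma homogeneous_polynomial_cmult:
  fixes P :: "complex ^ 'n \<Rightarrow> complex"
  assumes "homogeneous_polynomial k P"
  shows "homogeneous_polynomial k (\<lambda>z. c * P z)"
  using homogeneous_polynomial_sum[of "{()}" k "\<lambda>_. P" "\<lambda>_. c"] assms by simp

lemma homogeneous_polynomial_linear_power:
  fixes b :: "'n::finite \<Rightarrow> complex"
  shows "homogeneous_polynomial k (\<lambda>z :: complex ^ 'n. (\<Sum>i\<in>UNIV. b i * z $ i) ^ k)"
proof (induction k)
  case 0
  have "{\<alpha> :: 'n \<Rightarrow> nat. (\<Sum>i\<in>UNIV. \<alpha> i) = 0} = {\<lambda>_. 0}" by auto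
  then show ?case
    unfolding homogeneous_polynomial_def by (intro exI[of _ "\<lambda>_. 1"]) simp
next
  case (Suc k)
  have "homogeneous_polynomial (Suc k)
      (\<lambda>z :: complex ^ 'n. \<Sum>i\<in>UNIV. b i * (z $ i * (\<Sum>i\<in>UNIV. b i * z $ i) ^ k))"
    by (intro homogeneous_polynomial_sum homogeneous_polynomial_coordinate_mult Suc.IH)
  then show ?case
    by (simp add: sum_distrib_right mult.assoc)
qed

section \<open>A linear form that maps a convex circular domain onto the unit disc\<close>

text \<open>
  A hyperplane separating \<open>Q\<close> from a point outside gives a complex-linear \<open>L\<close> whose real part is
  bounded above on \<open>Q\<close>.  Rotating \<open>z\<close> makes \<open>L z\<close> real, so \<open>|L|\<close> has the same bound, and
  circularity forces the image of \<open>Q\<close> to be a disc, which is open because \<open>Q\<close> is.  The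
  functional is \<open>L\<close> divided by the radius of this disc.
\<close>

lemma convex_circular_obtain_functional:
  fixes Q :: "(complex ^ 'n) set"
  assumes Q: "complete_circular_domain Q" and conv: "convex Q" and proper: "Q \<noteq> UNIV"
  obtains b :: "'n \<Rightarrow> complex"
  where "\<And>z. z \<in> Q \<Longrightarrow> norm (\<Sum>i\<in>UNIV. b i * z $ i) < 1"
    and "\<And>w. norm w < 1 \<Longrightarrow> \<exists>z\<in>Q. (\<Sum>i\<in>UNIV. b i * z $ i) = w"
proof -
  have op: "open Q" and 0: "0 \<in> Q" 
    and circ: "\<And>\<xi> z. z \<in> Q \<Longrightarrow> norm \<xi> \<le> 1 \<Longrightarrow> \<xi> *s z \<in> Q"
    using Q by (auto simp: complete_circular_domain_def)
  obtain z1 where z1: "z1 \<notin> Q" using proper by blast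
  obtain v B where v: "v \<noteq> 0" and B: "\<And>z. z \<in> Q \<Longrightarrow> inner v z \<le> B"
    using separating_hyperplane_sets[OF conv, of "{z1}"] 0 z1 by auto
  define L where "L z = (\<Sum>i\<in>UNIV. cnj (v $ i) * z $ i)" for z
  have L_scale: "L (\<xi> *s z) = \<xi> * L z" for \<xi> z
    by (simp add: L_def sum_distrib_left mult_ac)
  have Re_L: "Re (L z) = inner v z" for z
    by (simp add: L_def inner_vec_def inner_complex_def)
  have bound: "norm (L z) \<le> B" if z: "z \<in> Q" for z
  proof -
    obtain \<omega> where \<omega>: "norm \<omega> = 1" "L z = \<omega> * of_real (norm (L z))"
      using obtain_phase by blast
    have "cnj \<omega> * \<omega> = 1"
      using \<omega>(1) by (simp add: complex_norm_square[symmetric] mult.commute)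
    then have "L (cnj \<omega> *s z) = of_real (norm (L z))"
      unfolding L_scale by (subst \<omega>(2)) (simp add: mult.assoc[symmetric])
    then have "norm (L z) = inner v (cnj \<omega> *s z)"
      unfolding Re_L[symmetric] by simp
    also have "\<dots> \<le> B" using B circ[OF z] \<omega>(1) by simp
    finally show ?thesis .
  qed
  define s where "s = (SUP z\<in>Q. norm (L z))"
  have bdd: "bdd_above ((\<lambda>z. norm (L z)) ` Q)"
    using bound by (intro bdd_aboveI2)
  have le_s: "norm (L z) \<le> s" if "z \<in> Q" for z
    unfolding s_def using that bdd by (rule cSUP_upper)
  have "((\<lambda>e. e *\<^sub>R v) \<longlongrightarrow> 0 *\<^sub>R v) (at_right 0)" by (intro tendsto_intros)
  then have "eventually (\<lambda>e. e *\<^sub>R v \<in> Q) (at_right 0)"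
    using op 0 by (intro topological_tendstoD) auto
  moreover have "eventually (\<lambda>e::real. 0 < e) (at_right 0)" by (rule eventually_at_right_less)
  ultimately have "eventually (\<lambda>e. 0 < e \<and> e *\<^sub>R v \<in> Q) (at_right 0)" by eventually_elim simp
  then obtain e where e: "0 < e" "e *\<^sub>R v \<in> Q"
    using eventually_happens'[OF trivial_limit_at_right_real] by blast
  \<comment> \<open>A small multiple of the normal vector shows that the supremum is positive.\<close>
  have "0 < inner v (e *\<^sub>R v)" using e v by simp
  also have "\<dots> \<le> norm (L (e *\<^sub>R v))" unfolding Re_L[symmetric] by (rule complex_Re_le_cmod)
  also have "\<dots> \<le> s" by (rule le_s[OF e(2)])
  finally have s: "0 < s" .
  have less_s: "norm (L z) < s" if z: "z \<in> Q" for z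
  proof (cases "L z = 0")
    case False
    obtain t where t: "1 < t" "of_real t *s z \<in> Q"
      using open_obtain_dilation[OF op z] by blast
    \<comment> \<open>The supremum is not attained, since the open domain contains a dilation of each point.\<close>
    have "norm (L z) < t * norm (L z)" using t False by simp
    also have "\<dots> = norm (L (of_real t *s z))" using t by (simp add: L_scale norm_mult)
    also have "\<dots> \<le> s" by (rule le_s[OF t(2)])
    finally show ?thesis .
  qed (use s in simp)
  have onto: "\<exists>z\<in>Q. L z = w * of_real s" if w: "norm w < 1" for w
  proof -
    \<comment> \<open>Some point of the domain overshoots the modulus wanted; circularity scales it back.\<close>
    have "norm w * s < s" using w s by simp
    then obtain z where z: "z \<in> Q" "norm w * s < norm (L z)"
      unfolding s_def using less_cSUP_iff[OF _ bdd] 0 by (metis empty_iff)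
    have nz: "norm (L z) > 0" using z(2) s mult_nonneg_nonneg[of "norm w" s] norm_ge_zero[of w] by linarith
    have "norm (w * of_real s / L z) \<le> 1"
      using z(2) s nz by (simp add: norm_divide norm_mult)
    from circ[OF z(1) this] show ?thesis
      by (rule bexI[rotated]) (use nz in \<open>simp add: L_scale\<close>)
  qed
  have div: "(\<Sum>i\<in>UNIV. cnj (v $ i) / of_real s * z $ i) = L z / of_real s" for z
    by (simp add: L_def sum_divide_distrib)
  show thesis
  proof (rule that[of "\<lambda>i. cnj (v $ i) / of_real s"], unfold div)
    show "norm (L z / of_real s) < 1" if "z \<in> Q" for z
      using less_s[OF that] s by (simp add: norm_divide)
    show "\<exists>z\<in>Q. L z / of_real s = w" if "norm w < 1" for w
      using onto[OF that] s by (auto simp: field_simps)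
  qed
qed

section \<open>The extremal function\<close>

text \<open>
  The disc automorphism with value \<open>a\<close> at the origin.  It attains equality in \<open>coefficient_sums\<close> and,
  on the negative real axis, in \<open>schwarz_pick_origin\<close>.
\<close>

definition extremal_fun :: "real \<Rightarrow> complex \<Rightarrow> complex" where
  "extremal_fun a w = (of_real a - w) / (1 - of_real a * w)"

definition extremal_coeff :: "real \<Rightarrow> nat \<Rightarrow> complex" where
  "extremal_coeff a k = (if k = 0 then of_real a else - of_real ((1 - a\<^sup>2) * a ^ (k - 1)))"

lemma norm_of_real_mult_less_one:
  assumes "0 \<le> a" "a < 1" "norm w < 1"
  shows "norm (of_real a * w :: complex) < 1"
  using assms mult_strict_mono'[of a 1 "norm w" 1] by (simp add: norm_mult)

lemma extremal_fun_sums: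
  assumes "0 \<le> a" "a < 1" "norm w < 1"
  shows "(\<lambda>k. extremal_coeff a k * w ^ k) sums extremal_fun a w"
proof -
  have n: "norm (of_real a * w) < 1" by (rule norm_of_real_mult_less_one[OF assms])
  then have nz: "1 - of_real a * w \<noteq> 0" by auto
  have "(\<lambda>k. - of_real (1 - a\<^sup>2) * w * (of_real a * w) ^ k) sums (- of_real (1 - a\<^sup>2) * w * (1 / (1 - of_real a * w)))"
    by (intro sums_mult geometric_sums n)
  moreover have "- of_real (1 - a\<^sup>2) * w * (of_real a * w) ^ k = extremal_coeff a (Suc k) * w ^ Suc k" for k
    by (simp add: extremal_coeff_def power_mult_distrib) (simp add: algebra_simps)
  ultimately have "(\<lambda>k. extremal_coeff a k * w ^ k) sums
      (- of_real (1 - a\<^sup>2) * w * (1 / (1 - of_real a * w)) + extremal_coeff a 0 * w ^ 0)"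
    using sums_Suc[where f = "\<lambda>k. extremal_coeff a k * w ^ k"] by (simp only:)
  also have "- of_real (1 - a\<^sup>2) * w * (1 / (1 - of_real a * w)) + extremal_coeff a 0 * w ^ 0 = extremal_fun a w"
    using nz by (simp add: extremal_coeff_def extremal_fun_def field_simps power2_eq_square)
  finally show ?thesis .
qed

text \<open>
  The left side is the weighted sum of the two coefficient series of \<open>extremal_fun\<close> at radius \<open>t\<close>:
  \<open>coefficient_sums\<close> holds with equality.
\<close>

lemma extremal_sums_identity:
  fixes a t :: real
  assumes a: "0 \<le> a" "a < 1" and t: "0 < t" "t < 1"
  shows "(1 - a\<^sup>2) * t / (1 - a * t)
     + (1 / (1 + a) + t / (1 - t)) * ((1 - a\<^sup>2)\<^sup>2 * t\<^sup>2 / (1 - (a * t)\<^sup>2)) = (1 - a\<^sup>2) * t / (1 - t)"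
proof -
  have "a * t < 1" using a t mult_strict_mono'[of a 1 t 1] by simp
  moreover have "0 \<le> a * t" using a t by simp
  ultimately have nz: "1 - a * t \<noteq> 0" "1 + a * t \<noteq> 0" "1 - t \<noteq> 0" "1 + a \<noteq> 0" using a t by linarith+
  define i j k l where "i = 1 / (1 - a * t)" and "j = 1 / (1 + a * t)" and "k = 1 / (1 - t)" and "l = 1 / (1 + a)"
  have inv: "(1 - a * t) * i = 1" "(1 + a * t) * j = 1" "(1 - t) * k = 1" "(1 + a) * l = 1"
    using nz by (simp_all add: i_def j_def k_def l_def)
  have fac: "1 / (1 - (a * t)\<^sup>2) = i * j"
    by (simp add: i_def j_def power2_eq_square algebra_simps)
  have "(1 - a\<^sup>2) * t * i + (l + t * k) * ((1 - a\<^sup>2)\<^sup>2 * t\<^sup>2 * (i * j)) = (1 - a\<^sup>2) * t * k"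
    using inv by algebra
  moreover have "(1 - a\<^sup>2)\<^sup>2 * t\<^sup>2 / (1 - (a * t)\<^sup>2) = (1 - a\<^sup>2)\<^sup>2 * t\<^sup>2 * (i * j)"
    unfolding fac[symmetric] by simp
  ultimately show ?thesis
    by (simp only: i_def k_def l_def times_divide_eq_right mult_1_right)
qed

lemma holomorphic_several_extremal:
  fixes b :: "'n::finite \<Rightarrow> complex"
  assumes a: "0 \<le> a" "a < 1" and lt: "\<And>z. z \<in> Q \<Longrightarrow> norm (\<Sum>i\<in>UNIV. b i * z $ i) < 1"
  shows "holomorphic_several (\<lambda>z. extremal_fun a (\<Sum>i\<in>UNIV. b i * z $ i)) Q"
  unfolding holomorphic_several_def
proof (intro ballI)
  fix z assume z: "z \<in> Q"
  let ?l = "\<lambda>z :: complex ^ 'n. \<Sum>i\<in>UNIV. b i * z $ i"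
  have l: "(?l has_derivative ?l) (at z)"
    by (intro bounded_linear_imp_has_derivative bounded_linear_sum
        bounded_linear_compose[OF bounded_linear_mult_right bounded_linear_vec_nth])
  have "1 - of_real a * ?l z \<noteq> 0"
    using norm_of_real_mult_less_one[OF a lt[OF z]] by auto
  then have "\<exists>d. (extremal_fun a has_field_derivative d) (at (?l z))"
    unfolding extremal_fun_def by (intro exI) (auto intro!: derivative_eq_intros)
  then obtain d where "(extremal_fun a has_field_derivative d) (at (?l z))" by blast
  then have "(extremal_fun a has_derivative (\<lambda>h. d * h)) (at (?l z))"
    by (simp add: has_field_derivative_def)
  from has_derivative_compose[OF l this]
  have "((\<lambda>z. extremal_fun a (?l z)) has_derivative (\<lambda>v. d * ?l v)) (at z)" .
  moreover have "d * ?l (c *s v) = c * (d * ?l v)" for c v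
    by (simp add: sum_distrib_left mult_ac)
  ultimately show "\<exists>D. ((\<lambda>z. extremal_fun a (?l z)) has_derivative D) (at z)
      \<and> (\<forall>(c::complex) v. D (c *s v) = c * D v)"
    by blast
qed

section \<open>Sharpness\<close>

text \<open>
  Composing the extremal function with a linear form \<open>l\<close> from \<open>Q\<close> onto the disc gives \<open>f\<close>.
  At a point where \<open>l z = -R\<close>, the sum with \<open>r = R\<close> equals one.  Such a point lies in
  \<open>\<rho> Q\<close> because \<open>R < \<rho>\<close>, and there is still room to take \<open>r\<close> slightly larger than \<open>R\<close>;
  the sum is strictly increasing in \<open>r\<close>, so it then exceeds one.
\<close>

lemma bohr_radius_sharp:
  fixes Q :: "(complex ^ 'n) set"
  assumes Q: "complete_circular_domain Q" and p: "p > 0" and conv: "convex Q" and proper: "Q \<noteq> UNIV"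
    and a: "0 \<le> a" "a < 1" and \<rho>: "min_root a p < \<rho>" "\<rho> \<le> 1"
  shows "\<exists>f P z r. holomorphic_several f Q \<and> homogeneous_expansion f P Q \<and>
                (\<forall>w\<in>Q. norm (f w) < 1) \<and> norm (f 0) = a \<and>
                z \<in> homothetic \<rho> Q \<and> 0 \<le> r \<and> r \<le> \<rho> \<and> r < 1 \<and>
                \<not> bohr_sum p a r f P z \<le> 1"
proof -
  define R where "R = min_root a p"
  have R: "0 < R" "R < 1" "A_fun a p R = 0" using min_root_is_root[OF a p] by (auto simp: R_def)
  have R\<rho>: "R < \<rho>" using \<rho> by (simp add: R_def)
  obtain b where lt: "\<And>z. z \<in> Q \<Longrightarrow> norm (\<Sum>i\<in>UNIV. b i * z $ i) < 1"
    and onto: "\<And>w. norm w < 1 \<Longrightarrow> \<exists>z\<in>Q. (\<Sum>i\<in>UNIV. b i * z $ i) = w"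
    using convex_circular_obtain_functional[OF Q conv proper] by blast
  define l where "l z = (\<Sum>i\<in>UNIV. b i * z $ i)" for z :: "complex ^ 'n"
  define f where "f z = extremal_fun a (l z)" for z
  define P where "P k z = extremal_coeff a k * l z ^ k" for k z
  have hol: "holomorphic_several f Q"
    using holomorphic_several_extremal[where b = b, OF a lt] unfolding f_def l_def .
  have expn: "homogeneous_expansion f P Q"
    unfolding homogeneous_expansion_def
  proof (intro conjI allI ballI)
    show "homogeneous_polynomial k (P k)" for k
      unfolding P_def l_def
      by (intro homogeneous_polynomial_cmult homogeneous_polynomial_linear_power)
    show "(\<lambda>k. P k z) sums f z" if "z \<in> Q" for z
      unfolding P_def f_def using lt[OF that] by (intro extremal_fun_sums a) (simp add: l_def)
  qed
  have bd: "norm (f w) < 1" if "w \<in> Q" for w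
  proof -
    have "norm ((l w - of_real a) / (1 - cnj (of_real a) * l w)) < 1"
      using a lt[OF that] by (intro norm_moebius_less_one) (simp_all add: l_def)
    then show ?thesis
      by (simp add: f_def extremal_fun_def norm_divide norm_minus_commute)
  qed
  have f0: "norm (f 0) = a" using a by (simp add: f_def l_def extremal_fun_def)
  have "R / \<rho> < 1" using R R\<rho> by simp
  then have "norm (- of_real (R / \<rho>) :: complex) < 1"
    using R R\<rho> by (simp add: norm_divide)
  then obtain y where y: "y \<in> Q" "l y = - of_real (R / \<rho>)"
    using onto unfolding l_def by blast
  define z where "z = \<rho> *\<^sub>R y"
  have z: "z \<in> homothetic \<rho> Q" using y by (auto simp: homothetic_def z_def)
  have lz: "l z = - of_real R"
  proof -
    have "l z = of_real \<rho> * l y"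
      unfolding z_def scaleR_eq_vector_smult l_def by (simp add: sum_distrib_left mult_ac)
    then show ?thesis using R R\<rho> by (simp add: y(2))
  qed
  have aR: "0 \<le> a * R" "a * R < 1" using a R mult_strict_mono'[of a 1 R 1] by simp_all
  have fz: "norm (f z) = (R + a) / (1 + a * R)"
  proof -
    have "f z = of_real ((R + a) / (1 + a * R))"
      by (simp add: f_def extremal_fun_def lz add.commute)
    then show ?thesis using R a aR by (simp only: norm_of_real) simp
  qed
  have a2: "0 < 1 - a\<^sup>2" using a by (simp add: abs_square_less_1)
  have Pz: "norm (P (Suc k) z) = (1 - a\<^sup>2) * R * (a * R) ^ k" for k
  proof -
    have "norm (P (Suc k) z) = \<bar>(1 - a\<^sup>2) * a ^ k\<bar> * R ^ Suc k"
      unfolding P_def lz norm_mult norm_power extremal_coeff_def using R(1)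
      by (simp add: norm_mult norm_power del: of_real_mult of_real_diff of_real_power power_Suc)
    also have "\<dots> = (1 - a\<^sup>2) * R * (a * R) ^ k"
      using a a2 by (simp add: abs_mult power_mult_distrib)
    finally show ?thesis .
  qed
  have s1: "(\<lambda>k. norm (P (Suc k) z)) sums ((1 - a\<^sup>2) * R * (1 / (1 - a * R)))"
    unfolding Pz using aR by (intro sums_mult geometric_sums) simp
  have s2: "(\<lambda>k. (norm (P (Suc k) z))\<^sup>2) sums (((1 - a\<^sup>2) * R)\<^sup>2 * (1 / (1 - (a * R)\<^sup>2)))"
  proof -
    have "(norm (P (Suc k) z))\<^sup>2 = ((1 - a\<^sup>2) * R)\<^sup>2 * ((a * R)\<^sup>2) ^ k" for k
      unfolding Pz by (simp only: power_mult_distrib power_mult[symmetric] mult.commute[of 2])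
    moreover have "norm ((a * R)\<^sup>2) < 1" using aR by (simp add: abs_square_less_1 power_less_one_iff)
    ultimately show ?thesis by (simp only:) (intro sums_mult geometric_sums)
  qed
  define S where "S = ((1 - a\<^sup>2) * R)\<^sup>2 * (1 / (1 - (a * R)\<^sup>2))"
  have "(a * R)\<^sup>2 < 1" using aR by (simp add: abs_square_less_1 power_less_one_iff)
  then have S: "0 < S" using a2 R by (simp add: S_def)
  define r where "r = (R + \<rho>) / 2"
  have r: "R < r" "r < \<rho>" "r < 1" using R\<rho> \<rho> by (auto simp: r_def)
  have "R / (1 - R) < r / (1 - r)"
    using r R by (intro frac_less) auto
  then have "(1 / (1 + a) + R / (1 - R)) * S < (1 / (1 + a) + r / (1 - r)) * S"
    using S by (intro mult_strict_right_mono) auto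
  moreover have "((R + a) / (1 + a * R)) powr p + ((1 - a\<^sup>2) * R * (1 / (1 - a * R)) + (1 / (1 + a) + R / (1 - R)) * S) = 1"
  proof -
    have "(1 - a\<^sup>2) * R * (1 / (1 - a * R)) + (1 / (1 + a) + R / (1 - R)) * S = (1 - a\<^sup>2) * R / (1 - R)"
      using extremal_sums_identity[OF a R(1,2)] unfolding S_def power_mult_distrib by simp
    then show ?thesis
      using A_fun_root_equation[OF a(1) less_imp_le[OF R(1)] R(2,3)] by (simp only:)
  qed
  ultimately have gt: "1 < norm (f z) powr p + (1 - a\<^sup>2) * R * (1 / (1 - a * R)) + (1 / (1 + a) + r / (1 - r)) * S"
    unfolding fz by linarith
  have "0 \<le> 1 / (1 + a) + r / (1 - r)"
    using r R a by (intro add_nonneg_nonneg divide_nonneg_nonneg) linarith+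
  then have "bohr_sum p a r f P z
      = ennreal (norm (f z) powr p + (1 - a\<^sup>2) * R * (1 / (1 - a * R)) + (1 / (1 + a) + r / (1 - r)) * S)"
    using bohr_sum_eq_ennreal[where P = P and z = z, OF sums_summable[OF s1] sums_summable[OF s2]]
      sums_unique[OF s1] sums_unique[OF s2] unfolding S_def by simp
  then have "\<not> bohr_sum p a r f P z \<le> 1"
    using gt by (simp only: ennreal_le_1 not_le)
  moreover have "0 \<le> r" "r \<le> \<rho>" using r R by auto
  ultimately show ?thesis
    using hol expn bd f0 z r(3) by blast
qed

theorem theorem5:
  fixes Q :: "(complex ^ 'n) set" and p :: real
  assumes "complete_circular_domain Q" and "p > 0"
  shows "(\<forall>f P a. holomorphic_several f Q \<and> homogeneous_expansion f P Q \<and>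
             (\<forall>z\<in>Q. norm (f z) < 1) \<and> a = norm (f 0) \<longrightarrow>
           (\<forall>z \<in> homothetic (min_root a p) Q. \<forall>r. 0 \<le> r \<and> r \<le> min_root a p \<longrightarrow>
              bohr_sum p a r f P z \<le> 1)) \<and>
         (convex Q \<and> Q \<noteq> UNIV \<longrightarrow>
           (\<forall>a \<rho>. 0 \<le> a \<and> a < 1 \<and> min_root a p < \<rho> \<and> \<rho> \<le> 1 \<longrightarrow>
             (\<exists>f P z r. holomorphic_several f Q \<and> homogeneous_expansion f P Q \<and>
                (\<forall>w\<in>Q. norm (f w) < 1) \<and> norm (f 0) = a \<and>
                z \<in> homothetic \<rho> Q \<and> 0 \<le> r \<and> r \<le> \<rho> \<and> r < 1 \<and>
                \<not> bohr_sum p a r f P z \<le> 1)))"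
proof (intro conjI allI impI ballI)
  fix f P a z r
  assume "holomorphic_several f Q \<and> homogeneous_expansion f P Q \<and> (\<forall>z\<in>Q. norm (f z) < 1) \<and> a = norm (f 0)"
    and "z \<in> homothetic (min_root a p) Q" and "0 \<le> r \<and> r \<le> min_root a p"
  then show "bohr_sum p a r f P z \<le> 1"
    by (intro bohr_inequality[OF assms]) auto
next
  fix a \<rho>
  assume "convex Q \<and> Q \<noteq> UNIV" and "0 \<le> a \<and> a < 1 \<and> min_root a p < \<rho> \<and> \<rho> \<le> 1"
  then show "\<exists>f P z r. holomorphic_several f Q \<and> homogeneous_expansion f P Q \<and>
                (\<forall>w\<in>Q. norm (f w) < 1) \<and> norm (f 0) = a \<and>
                z \<in> homothetic \<rho> Q \<and> 0 \<le> r \<and> r \<le> \<rho> \<and> r < 1 \<and>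
                \<not> bohr_sum p a r f P z \<le> 1"
    by (intro bohr_radius_sharp[OF assms]) auto
qed

end
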